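(* Let $n$ be a natural number, let $X=\{1,\dots,n\}$, and let $G\le S_n$ be a primitive non-synchronizing group on $X$ with $m(G)=2$ and $M(G)\le 1/2$. If $t\in T_n$ is a transformation whose kernel $\mathrm{Ker}(t)$ is a non-uniform partition of $X$, then the semigroup $\langle G,t\rangle$ contains a constant map. That is, $G$ is almost synchronizing.
   Context: $S_n$ and $T_n$ are the symmetric group and the full transformation monoid on $X=\{1,\dots,n\}$; maps act on the right. The kernel of $t\in T_n$ is the partition of $X$ in which $x,y$ lie in the same block iff $xt=yt$. A partition is uniform if all its blocks have the same size, and non-uniform otherwise. Let $G\le S_n$ be primitive. A set $S\subseteq X$ is a $G$-regular section for a partition $P$ of $X$ if $|Sg\cap T|=1$ for every $g\in G$ and every part $T$ of $P$. A non-synchronizing partition for $G$ is a partition $P$ of $X$ which has a $G$-regular section $S$ with $1<|S|<n$. $G$ is non-synchronizing if it has a non-synchronizing partition. For $S\subseteq X$ with $1<|S|<n$, let $\Gamma_S$ be the graph on $X$ in which distinct $x,y$ are adjacent iff there is $g\in G$ with $\{xg,yg\}\subseteq S$; let $\overline{\Gamma}_S$ be its complement, and let $\overline{\Gamma}_S[x]$ be the closed neighbourhood of $x$ in $\overline{\Gamma}_S$ ($x$ together with all its neighbours). If $T$ is a clique of $\overline{\Gamma}_S$ which meets every translate $Sg$ ($g\in G$), then $m(S,T)$ is the smallest number $m$ such that the intersection of the closed neighbourhoods in $\overline{\Gamma}_S$ of any $m$ points of $T$ equals $T$; equivalently, $m(S,T)$ is one more than the maximum number of neighbours in $T$, in the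 graph $\overline{\Gamma}_S$, of a point outside $T$. For a non-synchronizing group $G$, $m(G)$ is the maximum of $m(S,T)$ over all pairs $(S,T)$ such that $T$ is a part of a non-synchronizing partition $P$ for which $S$ is a $G$-regular section (with $1<|S|<n$). For two distinct non-synchronizing partitions $P,P'$ for $G$ with the same number $k$ of parts (the rank), $M(P,P')=|P\cap P'|/k$, where $|P\cap P'|$ is the number of common parts; $M(G)$ is the maximum of $M(P,P')$ over all such pairs. The condition $M(G)\le 1/2$ means that $M(P,P')\le 1/2$ for all such pairs. A primitive group $G\le S_n$ is almost synchronizing if for every $t\in T_n$ with non-uniform kernel the semigroup $\langle G,t\rangle$ contains a constant map. *)

theory Defs
  imports "HOL-Algebra.Sym_Groups" "HOL-Library.Disjoint_Sets" Complex_Main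
begin

section \<open>Transformations of \<open>{1..n}\<close>\<close>

text \<open>
  As for the library's \<^const>\<open>sym_group\<close>, a transformation of \<open>{1..n}\<close> is a function
  on \<^typ>\<open>nat\<close> that fixes everything outside \<open>{1..n}\<close>. The image \<open>xt\<close> of a point under a
  right action is written \<open>t x\<close>, and the translate \<open>Sg\<close> of a set is \<open>g ` S\<close>.
\<close>

definition full_transformations :: "nat \<Rightarrow> (nat \<Rightarrow> nat) set" where
  "full_transformations n = {t. t ` {1..n} \<subseteq> {1..n} \<and> (\<forall>x. x \<notin> {1..n} \<longrightarrow> t x = x)}"

definition kernel_partition :: "nat \<Rightarrow> (nat \<Rightarrow> nat) \<Rightarrow> nat set set" where
  "kernel_partition n t = {1..n} // {(x, y). x \<in> {1..n} \<and> y \<in> {1..n} \<and> t x = t y}"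

definition uniform :: "'a set set \<Rightarrow> bool" where
  "uniform P \<longleftrightarrow> (\<forall>A\<in>P. \<forall>B\<in>P. card A = card B)"

inductive_set semigroup_generated :: "('a \<Rightarrow> 'a) set \<Rightarrow> ('a \<Rightarrow> 'a) set"
  for A :: "('a \<Rightarrow> 'a) set" where
  incl: "f \<in> A \<Longrightarrow> f \<in> semigroup_generated A"
| comp: "f \<in> semigroup_generated A \<Longrightarrow> g \<in> semigroup_generated A \<Longrightarrow> g \<circ> f \<in> semigroup_generated A"

definition constant_map :: "nat \<Rightarrow> (nat \<Rightarrow> nat) \<Rightarrow> bool" where
  "constant_map n f \<longleftrightarrow> (\<exists>c\<in>{1..n}. \<forall>x\<in>{1..n}. f x = c)"


section \<open>Primitive groups and non-synchronizing partitions\<close>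

definition primitive_group :: "nat \<Rightarrow> (nat \<Rightarrow> nat) set \<Rightarrow> bool" where
  "primitive_group n G \<longleftrightarrow>
     subgroup G (sym_group n) \<and>
     (\<forall>x\<in>{1..n}. \<forall>y\<in>{1..n}. \<exists>g\<in>G. g x = y) \<and>
     (\<forall>P. partition_on {1..n} P \<and> (\<forall>g\<in>G. \<forall>B\<in>P. g ` B \<in> P) \<longrightarrow>
          P = {{1..n}} \<or> P = (\<lambda>x. {x}) ` {1..n})"

definition regular_section :: "nat \<Rightarrow> (nat \<Rightarrow> nat) set \<Rightarrow> nat set set \<Rightarrow> nat set \<Rightarrow> bool" where
  "regular_section n G P S \<longleftrightarrow>
     S \<subseteq> {1..n} \<and> (\<forall>g\<in>G. \<forall>T\<in>P. card (g ` S \<inter> T) = 1)"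

definition nonsync_partition :: "nat \<Rightarrow> (nat \<Rightarrow> nat) set \<Rightarrow> nat set set \<Rightarrow> bool" where
  "nonsync_partition n G P \<longleftrightarrow>
     partition_on {1..n} P \<and> (\<exists>S. regular_section n G P S \<and> 1 < card S \<and> card S < n)"

definition nonsynchronizing :: "nat \<Rightarrow> (nat \<Rightarrow> nat) set \<Rightarrow> bool" where
  "nonsynchronizing n G \<longleftrightarrow> (\<exists>P. nonsync_partition n G P)"


section \<open>The graph of a section and the parameter \<open>m(G)\<close>\<close>

text \<open>Graphs are given by their adjacency relation on the vertex set \<open>{1..n}\<close>.\<close>

definition section_graph :: "nat \<Rightarrow> (nat \<Rightarrow> nat) set \<Rightarrow> nat set \<Rightarrow> nat \<Rightarrow> nat \<Rightarrow> bool" where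
  "section_graph n G S x y \<longleftrightarrow>
     x \<in> {1..n} \<and> y \<in> {1..n} \<and> x \<noteq> y \<and> (\<exists>g\<in>G. {g x, g y} \<subseteq> S)"

definition section_cograph :: "nat \<Rightarrow> (nat \<Rightarrow> nat) set \<Rightarrow> nat set \<Rightarrow> nat \<Rightarrow> nat \<Rightarrow> bool" where
  "section_cograph n G S x y \<longleftrightarrow>
     x \<in> {1..n} \<and> y \<in> {1..n} \<and> x \<noteq> y \<and> \<not> section_graph n G S x y"

definition closed_nbhd :: "nat \<Rightarrow> (nat \<Rightarrow> nat) set \<Rightarrow> nat set \<Rightarrow> nat \<Rightarrow> nat set" where
  "closed_nbhd n G S x = insert x {y. section_cograph n G S x y}"

text \<open>
  The parameter \<open>m(S,T)\<close> is meant for cliques \<open>T\<close> of the complementary graph that meet every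
  translate of \<open>S\<close>; the lemma \<open>nonsync_part_clique\<close> below shows that this holds for every pair
  entering \<open>m(G)\<close>. Intersections are taken inside \<open>{1..n}\<close>, so that the intersection over
  no points (\<open>m = 0\<close>) is \<open>{1..n}\<close>.
\<close>

definition m_pair :: "nat \<Rightarrow> (nat \<Rightarrow> nat) set \<Rightarrow> nat set \<Rightarrow> nat set \<Rightarrow> nat" where
  "m_pair n G S T =
     (LEAST m. \<forall>A. A \<subseteq> T \<and> card A = m \<longrightarrow> {1..n} \<inter> (\<Inter>x\<in>A. closed_nbhd n G S x) = T)"

definition m_pairs :: "nat \<Rightarrow> (nat \<Rightarrow> nat) set \<Rightarrow> (nat set \<times> nat set) set" where
  "m_pairs n G =
     {(S, T). 1 < card S \<and> card S < n \<and>
        (\<exists>P. partition_on {1..n} P \<and> regular_section n G P S \<and> T \<in> P)}"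

definition m_group :: "nat \<Rightarrow> (nat \<Rightarrow> nat) set \<Rightarrow> nat" where
  "m_group n G = Max ((\<lambda>(S, T). m_pair n G S T) ` m_pairs n G)"

lemma nonsync_part_clique:
  assumes G: "subgroup G (sym_group n)" and ST: "(S, T) \<in> m_pairs n G"
  shows "T \<subseteq> {1..n}" and "pairwise (section_cograph n G S) T"
    and "\<forall>g\<in>G. g ` S \<inter> T \<noteq> {}"
proof -
  from ST obtain P where P: "partition_on {1..n} P" "regular_section n G P S" "T \<in> P"
    by (auto simp: m_pairs_def)
  show T: "T \<subseteq> {1..n}"
    using P by (auto simp: partition_on_def)
  show "\<forall>g\<in>G. g ` S \<inter> T \<noteq> {}"
    using P by (fastforce simp: regular_section_def)
  have False if xy: "x \<in> T" "y \<in> T" "x \<noteq> y" and g: "g \<in> G" "{g x, g y} \<subseteq> S" for x y g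
  proof -
    have gp: "g permutes {1..n}"
      using G g(1) by (metis subgroup.mem_carrier sym_group_carrier)
    have "inv' g \<in> G"
      using G g(1) by (metis subgroup.m_inv_closed subgroup.mem_carrier sym_group_inv_equality)
    then have "card (inv' g ` S \<inter> T) = 1"
      using P by (auto simp: regular_section_def)
    then obtain z where "inv' g ` S \<inter> T = {z}"
      by (auto simp: card_1_singleton_iff)
    moreover have "x \<in> inv' g ` S" "y \<in> inv' g ` S"
      using g(2) gp by (auto simp: image_iff intro: permutes_inverses(2)[symmetric])
    ultimately show False using xy by (metis IntI singletonD)
  qed
  then show "pairwise (section_cograph n G S) T"
    using T by (fastforce simp: pairwise_def section_cograph_def section_graph_def)
qed

lemma finite_m_pairs: "finite (m_pairs n G)"
proof (rule finite_subset)
  show "m_pairs n G \<subseteq> Pow {1..n} \<times> Pow {1..n}"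
    by (auto simp: m_pairs_def regular_section_def partition_on_def)
qed simp

lemma m_pairs_nonempty: "m_pairs n G \<noteq> {}" if "nonsynchronizing n G"
proof -
  from that obtain P S where P: "partition_on {1..n} P" "regular_section n G P S"
    and S: "1 < card S" "card S < n"
    by (auto simp: nonsynchronizing_def nonsync_partition_def)
  have "P \<noteq> {}" using P(1) S by (auto simp: partition_on_def)
  then obtain T where "T \<in> P" by auto
  then have "(S, T) \<in> m_pairs n G" using P S by (auto simp: m_pairs_def)
  then show ?thesis by auto
qed


section \<open>The parameter \<open>M(G)\<close> and almost synchronizing groups\<close>

text \<open>For partitions of the same rank only, so that the denominator is the common rank.\<close>

definition M_pair :: "nat set set \<Rightarrow> nat set set \<Rightarrow> real" where
  "M_pair P P' = real (card (P \<inter> P')) / real (card P)"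

text \<open>
  \<open>M(G) \<le> r\<close>, i.e. a bound on the maximum of \<open>M(P,P')\<close>. It is rendered as a predicate because
  there may be no pair of distinct non-synchronizing partitions of the same rank; the bound
  then holds vacuously.
\<close>

definition M_group_le :: "nat \<Rightarrow> (nat \<Rightarrow> nat) set \<Rightarrow> real \<Rightarrow> bool" where
  "M_group_le n G r \<longleftrightarrow>
     (\<forall>P P'. nonsync_partition n G P \<and> nonsync_partition n G P' \<and> P \<noteq> P' \<and> card P = card P'
        \<longrightarrow> M_pair P P' \<le> r)"

definition almost_synchronizing :: "nat \<Rightarrow> (nat \<Rightarrow> nat) set \<Rightarrow> bool" where
  "almost_synchronizing n G \<longleftrightarrow>
     primitive_group n G \<and>
     (\<forall>t\<in>full_transformations n. \<not> uniform (kernel_partition n t) \<longrightarrow>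
        (\<exists>f\<in>semigroup_generated (insert t G). constant_map n f))"

end

theory Submission
  imports Defs
begin

text \<open>
  Suppose \<open>\<langle>G,t\<rangle>\<close> contains no constant map. Call the kernel classes of its elements of minimal
  rank lines. By Neumann's argument the image of any such element is a \<open>G\<close>-regular section for the
  kernel of any other, so all lines have the same size \<open>l > 1\<close>, and \<open>m(G) \<le> 2\<close> says that distinct
  lines meet in at most one point. The set of lines is invariant under \<open>G\<close> and under taking
  preimages by \<open>t\<close>; by primitivity every point lies on two lines, and the collinearity graph is
  connected.

  If a fibre \<open>F\<close> of \<open>t\<close> over \<open>p\<close> has two points, then the preimages of two lines through \<open>p\<close> share
  these two points and hence coincide; as the two lines meet only in \<open>p\<close>, the fibre \<open>F\<close> itself is a
  line. So nonempty fibres have size \<open>1\<close> or \<open>l\<close>. Since preimages of lines have size \<open>l\<close>, a line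
  through a point whose fibre is a singleton consists of such points only. By connectedness either
  all points or no points have singleton fibres, and the kernel of \<open>t\<close> is uniform.
\<close>

section \<open>Kernel classes as fibres, and generated semigroups\<close>

lemma kernel_partition_eq:
  "kernel_partition n f = (\<lambda>c. {x \<in> {1..n}. f x = c}) ` f ` {1..n}"
  unfolding kernel_partition_def quotient_def UNION_singleton_eq_range image_image
  by (rule image_cong) auto

lemma full_transformations_comp:
  "f \<in> full_transformations n \<Longrightarrow> g \<in> full_transformations n \<Longrightarrow> g \<circ> f \<in> full_transformations n"
  unfolding full_transformations_def by (auto simp: image_subset_iff)

lemma semigroup_generated_subset:
  assumes "A \<subseteq> full_transformations n" "f \<in> semigroup_generated A"
  shows "f \<in> full_transformations n"
  using assms(2)
proof induction
  case (incl f)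
  then show ?case using assms(1) by auto
next
  case (comp f g)
  then show ?case by (simp only: full_transformations_comp)
qed

section \<open>Pointwise form of the bound \<open>m_group n G \<le> 2\<close>\<close>

lemma m_pair_inter:
  assumes ST: "(S, T) \<in> m_pairs n G" and m: "m_group n G \<le> 2"
    and xy: "x \<in> T" "y \<in> T" "x \<noteq> y"
    and z: "z \<in> {1..n}" "z \<in> closed_nbhd n G S x" "z \<in> closed_nbhd n G S y"
  shows "z \<in> T"
proof -
  define Q where "Q = (\<lambda>m. \<forall>A. A \<subseteq> T \<and> card A = m
    \<longrightarrow> {1..n} \<inter> (\<Inter>x\<in>A. closed_nbhd n G S x) = T)"
  have T: "finite T"
    using ST by (auto simp: m_pairs_def partition_on_def intro: finite_subset)
  \<comment> \<open>\<open>T\<close> has no subset of this size, so \<open>Q\<close> holds vacuously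
    there. This guarantees that the \<open>LEAST\<close> in \<open>m_pair\<close> is
    attained.\<close>
  have "Q (Suc (card T))"
    unfolding Q_def
  proof (intro allI impI, elim conjE)
    fix A assume "A \<subseteq> T" "card A = Suc (card T)"
    then have False using card_mono[OF T, of A] by simp
    then show "{1..n} \<inter> (\<Inter>x\<in>A. closed_nbhd n G S x) = T" ..
  qed
  then have Q: "Q (m_pair n G S T)"
    unfolding m_pair_def Q_def by (rule LeastI)
  have "m_pair n G S T \<le> m_group n G"
    unfolding m_group_def using ST finite_m_pairs by (intro Max_ge) auto
  \<comment> \<open>The parameter may be smaller than 2, so \<open>Q\<close> is applied to a subset
    \<open>A\<close> of \<open>{x, y}\<close>. Since \<open>z\<close> lies in the neighbourhoods of
    both points, it lies in the intersection over \<open>A\<close>.\<close>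
  then have "m_pair n G S T \<le> card {x, y}"
    using m xy by simp
  then obtain A where A: "A \<subseteq> {x, y}" "card A = m_pair n G S T"
    using obtain_subset_with_card_n by metis
  then have "{1..n} \<inter> (\<Inter>x\<in>A. closed_nbhd n G S x) = T"
    using Q xy unfolding Q_def by blast
  then show ?thesis
    using A(1) z by blast
qed

text \<open>A hypothetical counterexample \<open>t\<close>, fixed in order to be refuted. The bound
  on \<open>m_group\<close> is passed explicitly to the lemmas that use it.\<close>

locale constant_free =
  fixes n :: nat and G :: "(nat \<Rightarrow> nat) set" and t :: "nat \<Rightarrow> nat"
  assumes primitive: "primitive_group n G"
    and t_full: "t \<in> full_transformations n"
    and nonuniform: "\<not> uniform (kernel_partition n t)"
    and no_constant: "\<And>f. f \<in> semigroup_generated (insert t G) \<Longrightarrow> \<not> constant_map n f"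
begin

definition X :: "nat set" where "X = {1..n}"

abbreviation M :: "(nat \<Rightarrow> nat) set" where "M \<equiv> semigroup_generated (insert t G)"

definition rank :: "(nat \<Rightarrow> nat) \<Rightarrow> nat" where "rank f = card (f ` X)"

definition minimal :: "(nat \<Rightarrow> nat) \<Rightarrow> bool" where
  "minimal u \<longleftrightarrow> u \<in> M \<and> (\<forall>f\<in>M. rank u \<le> rank f)"

definition lines :: "nat set set" where
  "lines = (\<Union>u\<in>Collect minimal. kernel_partition n u)"

lemma finite_X [simp]: "finite X" and card_X [simp]: "card X = n"
  by (simp_all add: X_def)

lemma kernel_partition_X: "kernel_partition n f = (\<lambda>c. {x \<in> X. f x = c}) ` f ` X"
  by (simp add: kernel_partition_eq X_def)

section \<open>Basic facts on the group and the semigroup\<close>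

lemma subgroup_G: "subgroup G (sym_group n)"
  using primitive by (simp add: primitive_group_def)

lemma permutes: "g \<in> G \<Longrightarrow> g permutes X"
  unfolding X_def using subgroup_G by (metis subgroup.mem_carrier sym_group_carrier)

lemma inv_closed: "g \<in> G \<Longrightarrow> inv' g \<in> G"
  using subgroup_G
  by (metis subgroup.m_inv_closed subgroup.mem_carrier sym_group_inv_equality)

lemma comp_closed: "g \<in> G \<Longrightarrow> h \<in> G \<Longrightarrow> g \<circ> h \<in> G"
  using subgroup.m_closed[OF subgroup_G] by (simp add: sym_group_def)

lemma id_closed: "id \<in> G"
  using subgroup.one_closed[OF subgroup_G] by (simp add: sym_group_def)

lemma transitive_G: "x \<in> X \<Longrightarrow> y \<in> X \<Longrightarrow> \<exists>g\<in>G. g x = y"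
  using primitive by (simp add: primitive_group_def X_def)

lemma finite_G: "finite G"
proof (rule finite_subset)
  show "G \<subseteq> {p. p permutes X}" using permutes by blast
qed (simp add: finite_permutations)

lemma primitive_partition:
  assumes "partition_on X P" "\<And>g B. g \<in> G \<Longrightarrow> B \<in> P \<Longrightarrow> g ` B \<in> P"
  shows "P = {X} \<or> P = (\<lambda>x. {x}) ` X"
  using primitive assms by (simp add: primitive_group_def X_def)

lemma image_X: "g \<in> G \<Longrightarrow> g ` X = X"
  using permutes permutes_image by blast

lemma G_in_M: "g \<in> G \<Longrightarrow> g \<in> M"
  by (simp add: semigroup_generated.incl)

lemma t_in_M: "t \<in> M"
  by (simp add: semigroup_generated.incl)

lemma M_full: "f \<in> M \<Longrightarrow> f \<in> full_transformations n"
proof (rule semigroup_generated_subset[where A = "insert t G"])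
  show "insert t G \<subseteq> full_transformations n"
    using t_full image_X permutes by (auto simp: full_transformations_def permutes_def X_def)
qed

lemma M_image: "f \<in> M \<Longrightarrow> f ` X \<subseteq> X"
  using M_full by (simp add: full_transformations_def X_def)

lemma X_nonempty: "X \<noteq> {}"
  using nonuniform by (auto simp: kernel_partition_X uniform_def)

lemma rank_gt_1: "f \<in> M \<Longrightarrow> 1 < rank f"
proof (rule ccontr)
  assume f: "f \<in> M" and "\<not> 1 < rank f"
  moreover have "rank f \<noteq> 0"
    using X_nonempty by (simp add: rank_def)
  ultimately have "card (f ` X) = 1"
    by (simp add: rank_def not_less le_Suc_eq)
  then obtain c where c: "f ` X = {c}"
    by (auto simp: card_1_singleton_iff)
  moreover have "\<forall>x\<in>X. f x = c"
    using c by blast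
  ultimately have "constant_map n f"
    using M_image[OF f] unfolding constant_map_def X_def by blast
  then show False using no_constant f by blast
qed

section \<open>Elements of minimal rank and regular sections\<close>

lemma minimal_exists: "\<exists>u. minimal u"
  using ex_has_least_nat[of "\<lambda>f. f \<in> M" t rank] t_in_M by (auto simp: minimal_def)

lemma minimal_in_M: "minimal u \<Longrightarrow> u \<in> M"
  by (simp add: minimal_def)

text \<open>An injective \<open>t\<close> would have only singleton kernel classes, hence a uniform
  kernel. So \<open>t\<close> has rank below \<open>n\<close>, and this bounds the minimal
  rank.\<close>

lemma rank_less_n:
  assumes "minimal u"
  shows "rank u < n"
proof -
  have "\<not> inj_on t X"
  proof
    assume inj: "inj_on t X"
    have "card A = 1" if A: "A \<in> kernel_partition n t" for A
    proof -
      obtain y where "y \<in> X" "A = {x \<in> X. t x = t y}"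
        using A unfolding kernel_partition_X by blast
      then have "A = {y}"
        using inj by (auto dest: inj_onD)
      then show ?thesis by simp
    qed
    then show False using nonuniform by (simp add: uniform_def)
  qed
  then have "rank t < card X"
    using card_image_le[of X t] inj_on_iff_eq_card[of X t] by (auto simp: rank_def)
  moreover have "rank u \<le> rank t"
    using assms t_in_M by (simp add: minimal_def)
  ultimately show ?thesis by simp
qed

text \<open>The image of \<open>u \<circ> f\<close> lies in that of \<open>u\<close>, and minimality
  of the rank of \<open>u\<close> leaves no room for a proper inclusion.\<close>

lemma minimal_comp:
  assumes "minimal u" "f \<in> M"
  shows "minimal (u \<circ> f)" "u ` f ` X = u ` X"
proof -
  have uf: "u \<circ> f \<in> M"
    using assms(2) minimal_in_M[OF assms(1)] by (rule semigroup_generated.comp)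
  have sub: "u ` f ` X \<subseteq> u ` X"
    using M_image[OF assms(2)] by auto
  have le: "rank u \<le> rank (u \<circ> f)"
    using assms(1) uf by (simp add: minimal_def)
  then show eq: "u ` f ` X = u ` X"
    using sub by (intro card_seteq) (auto simp: rank_def image_comp)
  show "minimal (u \<circ> f)"
    using assms(1) uf eq by (simp add: minimal_def rank_def image_comp)
qed

lemma rank_minimal: "minimal u \<Longrightarrow> minimal v \<Longrightarrow> rank u = rank v"
  by (simp add: minimal_def order_antisym)

lemma partition_kernel: "partition_on X (kernel_partition n f)"
  by (rule partition_onI) (auto simp: kernel_partition_X disjnt_def)

lemma regular_section_minimal:
  assumes u: "minimal u" and s: "minimal s"
  shows "regular_section n G (kernel_partition n u) (s ` X)"
  unfolding regular_section_def X_def[symmetric]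
proof (intro conjI ballI)
  show "s ` X \<subseteq> X"
    using s by (simp add: M_image minimal_in_M)
next
  fix g T
  assume g: "g \<in> G" and "T \<in> kernel_partition n u"
  then obtain c where c: "c \<in> u ` X" "T = {x \<in> X. u x = c}"
    by (auto simp: kernel_partition_X)
  have gs: "g \<circ> s \<in> M"
    using g s by (intro semigroup_generated.comp G_in_M minimal_in_M)
  have sub: "g ` s ` X \<subseteq> X"
    using M_image[OF gs] by (simp add: image_comp)
  have im: "u ` g ` s ` X = u ` X"
    using minimal_comp(2)[OF u gs] by (simp add: image_comp)
  have "card (g ` s ` X) \<le> card (s ` X)"
    by (simp add: card_image_le)
  also have "\<dots> = card (u ` X)"
    using rank_minimal[OF u s] by (simp add: rank_def)
  finally have "card (u ` g ` s ` X) = card (g ` s ` X)"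
    using im card_image_le[of "g ` s ` X" u] by simp
  then have inj: "inj_on u (g ` s ` X)"
    by (intro eq_card_imp_inj_on) auto
  have "c \<in> u ` g ` s ` X"
    using c im by simp
  then obtain y where y: "y \<in> g ` s ` X" "u y = c"
    by blast
  have "z = y" if "z \<in> g ` s ` X" "z \<in> T" for z
    using inj_onD[OF inj, of z y] that y c(2) by simp
  moreover have "y \<in> T"
    using y sub c(2) by blast
  ultimately have "g ` s ` X \<inter> T = {y}"
    using y(1) by blast
  then show "card (g ` s ` X \<inter> T) = 1" by simp
qed

lemma lines_m_pairs:
  assumes "T \<in> lines" "minimal s"
  shows "(s ` X, T) \<in> m_pairs n G"
proof -
  obtain u where u: "minimal u" "T \<in> kernel_partition n u"
    using assms by (auto simp: lines_def)
  have "1 < card (s ` X)" "card (s ` X) < n"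
    using rank_gt_1[OF minimal_in_M] rank_less_n assms(2) by (auto simp: rank_def)
  then show ?thesis
    using u regular_section_minimal[OF u(1) assms(2)] partition_kernel
    unfolding m_pairs_def X_def by blast
qed

section \<open>Double counting in a transitive group\<close>

lemma card_transporter:
  assumes "x \<in> X" "y \<in> X" "x' \<in> X" "y' \<in> X"
  shows "card {g \<in> G. g x = y} \<le> card {g \<in> G. g x' = y'}"
proof -
  obtain h where h: "h \<in> G" "h x' = x" using transitive_G assms by blast
  obtain k where k: "k \<in> G" "k y = y'" using transitive_G assms by blast
  \<comment> \<open>Multiplying by \<open>h\<close> and \<open>k\<close> on the two sides injects
    one transporter into the other. Exchanging the roles of the pairs gives the reverse inequality,
    hence equality of sizes.\<close>
  have "inj_on (\<lambda>g. k \<circ> g \<circ> h) {g \<in> G. g x = y}"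
  proof (rule inj_onI)
    fix f g assume "k \<circ> f \<circ> h = k \<circ> g \<circ> h"
    then have "k (f (h z)) = k (g (h z))" for z
      by (metis comp_apply)
    then have "f (h z) = g (h z)" for z
      using permutes_inj[OF permutes[OF k(1)]] by (auto dest: injD)
    then show "f = g"
      using permutes_surj[OF permutes[OF h(1)]] by (metis ext surjD)
  qed
  moreover have "(\<lambda>g. k \<circ> g \<circ> h) ` {g \<in> G. g x = y} \<subseteq> {g \<in> G. g x' = y'}"
    using h k by (auto intro!: comp_closed)
  ultimately show ?thesis
    using finite_G by (intro card_inj_on_le) auto
qed

text \<open>
  Neumann's double count: every point of \<open>S\<close> is carried to every point of \<open>T\<close> by the same number
  of elements of \<open>G\<close>, because \<open>G\<close> is transitive.
\<close>

lemma card_section_part: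
  assumes S: "S \<subseteq> X" and T: "T \<subseteq> X" and sec: "\<forall>g\<in>G. card (g ` S \<inter> T) = 1"
    and a: "a \<in> X"
  shows "card G = card S * card T * card {g \<in> G. g a = a}"
proof -
  have fin: "finite S" "finite T"
    using S T by (auto intro: finite_subset[OF _ finite_X])
  have "card G = (\<Sum>g\<in>G. card {p \<in> S \<times> T. g (fst p) = snd p})"
  proof -
    have "card {p \<in> S \<times> T. g (fst p) = snd p} = 1" if g: "g \<in> G" for g
    proof -
      have "bij_betw snd {p \<in> S \<times> T. g (fst p) = snd p} (g ` S \<inter> T)"
        using permutes_inj[OF permutes[OF g]]
        by (intro bij_betw_imageI) (auto simp: inj_on_def inj_def image_iff)
      then show ?thesis
        using sec g bij_betw_same_card by fastforce
    qed
    then show ?thesis by simp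
  qed
  also have "\<dots> = (\<Sum>p\<in>S \<times> T. card {g \<in> G. g (fst p) = snd p})"
    by (rule sum_multicount_gen) (use fin finite_G in auto)
  also have "\<dots> = (\<Sum>p\<in>S \<times> T. card {g \<in> G. g a = a})"
  proof (rule sum.cong)
    fix p assume "p \<in> S \<times> T"
    then have "fst p \<in> X" "snd p \<in> X" using S T by auto
    then show "card {g \<in> G. g (fst p) = snd p} = card {g \<in> G. g a = a}"
      using a by (intro order_antisym card_transporter)
  qed simp
  finally show ?thesis by (simp add: card_cartesian_product)
qed

section \<open>Lines: size and invariance\<close>

lemma line_subset: "T \<in> lines \<Longrightarrow> T \<subseteq> X"
  by (auto simp: lines_def kernel_partition_X)

lemma lines_cover: "x \<in> X \<Longrightarrow> \<exists>T\<in>lines. x \<in> T"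
  using minimal_exists by (fastforce simp: lines_def kernel_partition_X)

lemma card_lines:
  assumes "T \<in> lines" "T' \<in> lines"
  shows "card T = card T'"
proof -
  obtain s where s: "minimal s" using minimal_exists by blast
  obtain a where a: "a \<in> X" using X_nonempty by blast
  have *: "card G = card (s ` X) * card L * card {g \<in> G. g a = a}" if L: "L \<in> lines" for L
  proof (rule card_section_part[OF _ _ _ a])
    show "s ` X \<subseteq> X" using s by (simp add: M_image minimal_in_M)
    show "L \<subseteq> X" using L by (rule line_subset)
    show "\<forall>g\<in>G. card (g ` s ` X \<inter> L) = 1"
      using L regular_section_minimal[OF _ s] by (auto simp: lines_def regular_section_def)
  qed
  have "card G \<noteq> 0"
    using id_closed finite_G by auto
  then have "card (s ` X) \<noteq> 0" "card {g \<in> G. g a = a} \<noteq> 0"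
    using *[OF assms(1)] by auto
  moreover have "card (s ` X) * card T * card {g \<in> G. g a = a}
      = card (s ` X) * card T' * card {g \<in> G. g a = a}"
    by (rule trans[OF *[OF assms(1), symmetric] *[OF assms(2)]])
  ultimately show ?thesis by (simp only: mult_cancel1 mult_cancel2 simp_thms)
qed

text \<open>If one line had at most one point, all lines would, and a minimal \<open>u\<close> would
  be injective, against \<open>rank_less_n\<close>.\<close>

lemma card_line_ge_2:
  assumes "T \<in> lines"
  shows "2 \<le> card T"
proof (rule ccontr)
  assume "\<not> 2 \<le> card T"
  then have le: "card L \<le> 1" if "L \<in> lines" for L
    using card_lines[OF assms that] by simp
  obtain u where u: "minimal u" using minimal_exists by blast
  have "inj_on u X"
  proof (rule inj_onI)
    fix x y assume xy: "x \<in> X" "y \<in> X" "u x = u y"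
    have "{z \<in> X. u z = u x} \<in> lines"
      using u xy(1) by (auto simp: lines_def kernel_partition_X)
    from le[OF this] show "x = y"
      using xy by (auto simp: card_le_Suc0_iff_eq)
  qed
  then have "rank u = n"
    by (simp add: rank_def card_image)
  then show False using rank_less_n[OF u] by simp
qed

lemma X_not_line: "X \<notin> lines"
proof
  assume "X \<in> lines"
  then obtain u c where u: "minimal u" "c \<in> u ` X" "X = {x \<in> X. u x = c}"
    by (auto simp: lines_def kernel_partition_X)
  then have "u ` X = {c}" by blast
  then show False
    using rank_gt_1[OF minimal_in_M[OF u(1)]] by (simp add: rank_def)
qed

text \<open>The preimage under \<open>f\<close> of a kernel class of \<open>u\<close> is a kernel
  class of \<open>u \<circ> f\<close>, again minimal. It is nonempty because
  \<open>u \<circ> f\<close> and \<open>u\<close> have the same image.\<close>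

lemma line_vimage:
  assumes "f \<in> M" "T \<in> lines"
  shows "{x \<in> X. f x \<in> T} \<in> lines"
proof -
  obtain u c where u: "minimal u" "c \<in> u ` X" "T = {x \<in> X. u x = c}"
    using assms by (auto simp: lines_def kernel_partition_X)
  have "{x \<in> X. f x \<in> T} = {x \<in> X. (u \<circ> f) x = c}"
    using u(3) M_image[OF assms(1)] by auto
  moreover have "c \<in> (u \<circ> f) ` X"
    using u(2) minimal_comp(2)[OF u(1) assms(1)] by (simp add: image_comp)
  ultimately have "{x \<in> X. f x \<in> T} \<in> kernel_partition n (u \<circ> f)"
    unfolding kernel_partition_X by blast
  then show ?thesis
    using minimal_comp(1)[OF u(1) assms(1)] by (auto simp: lines_def)
qed

lemma line_image:
  assumes g: "g \<in> G" and T: "T \<in> lines"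
  shows "g ` T \<in> lines"
proof -
  have "g ` T = {x \<in> X. inv' g x \<in> T}"
  proof -
    have "x = g (inv' g x)" "inv' g (g x) = x" for x
      using permutes_inverses[OF permutes[OF g]] by simp_all
    moreover have "g ` T \<subseteq> X"
      using image_X[OF g] line_subset[OF T] by blast
    ultimately show ?thesis by (auto simp: image_iff)
  qed
  then show ?thesis
    using line_vimage[OF G_in_M[OF inv_closed[OF g]] T] by simp
qed

section \<open>Consequences of primitivity\<close>

lemma two_lines_exist: "\<exists>T\<in>lines. \<exists>T'\<in>lines. T \<noteq> T' \<and> T \<inter> T' \<noteq> {}"
proof (rule ccontr)
  \<comment> \<open>Pairwise disjoint lines would form a \<open>G\<close>-invariant partition,
    trivial by primitivity. Yet \<open>X\<close> is not a line, and lines have at least two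
    points.\<close>
  assume "\<not> ?thesis"
  then have disj: "disjoint lines"
    by (auto simp: disjoint_def)
  have "partition_on X lines"
  proof (rule partition_onI)
    show "{} \<notin> lines"
      using card_line_ge_2[of "{}"] by auto
    show "\<Union>lines = X"
      using line_subset lines_cover by blast
    show "disjnt p q" if "p \<in> lines" "q \<in> lines" "p \<noteq> q" for p q
      using disj that by (auto simp: disjoint_def disjnt_def)
  qed
  then have "lines = {X} \<or> lines = (\<lambda>x. {x}) ` X"
    using line_image by (rule primitive_partition)
  then show False
  proof
    assume "lines = {X}"
    then show False using X_not_line by simp
  next
    assume eq: "lines = (\<lambda>x. {x}) ` X"
    obtain x where "x \<in> X" using X_nonempty by blast
    then have "{x} \<in> lines" using eq by blast
    then show False using card_line_ge_2[of "{x}"] by simp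
  qed
qed

lemma two_lines:
  assumes "p \<in> X"
  obtains T T' where "T \<in> lines" "T' \<in> lines" "T \<noteq> T'" "p \<in> T" "p \<in> T'"
proof -
  obtain T T' q where T: "T \<in> lines" "T' \<in> lines" "T \<noteq> T'" "q \<in> T" "q \<in> T'"
    using two_lines_exist by blast
  obtain g where g: "g \<in> G" "g q = p"
    using transitive_G line_subset T assms by (meson subsetD)
  have "g ` T \<noteq> g ` T'"
    using T(3) permutes_inj[OF permutes[OF g(1)]] by (simp add: inj_image_eq_iff)
  moreover have "p \<in> g ` T" "p \<in> g ` T'"
    using g T by auto
  ultimately show ?thesis
    using that[of "g ` T" "g ` T'"] line_image[OF g(1)] T by blast
qed

text \<open>Within \<open>X\<close>, these are the unions of connected components of the
  collinearity graph; the encoding avoids paths.\<close>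

definition line_closed :: "nat set \<Rightarrow> bool" where
  "line_closed B \<longleftrightarrow> (\<forall>T\<in>lines. T \<inter> B \<noteq> {} \<longrightarrow> T \<subseteq> B)"

lemma line_closed_vimage:
  assumes "g \<in> G" "line_closed B"
  shows "line_closed (g -` B)"
proof -
  have "g ` T \<subseteq> B" if "T \<in> lines" "g ` T \<inter> B \<noteq> {}" for T
    using assms line_image that by (simp add: line_closed_def)
  then show ?thesis
    unfolding line_closed_def by blast
qed

text \<open>This is connectedness of the collinearity graph. Its components form a
  \<open>G\<close>-invariant partition, which has a part with at least two points, so primitivity
  leaves a single component.\<close>

lemma line_closed_eq_X:
  assumes B: "line_closed B" "B \<subseteq> X" "B \<noteq> {}"
  shows "B = X"
proof -
  \<comment> \<open>Points are related when no line-closed set separates them. \<open>G\<close>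
    preserves \<open>R\<close> since preimages of line-closed sets under \<open>G\<close> are
    line-closed.\<close>
  define R where "R = {(x, y). x \<in> X \<and> y \<in> X \<and> (\<forall>C. line_closed C \<longrightarrow> (x \<in> C \<longleftrightarrow> y \<in> C))}"
  have equiv: "equiv X R"
    unfolding R_def by (intro equivI refl_onI symI transI) auto
  have R_G: "(g x, g y) \<in> R" if "(x, y) \<in> R" "g \<in> G" for g x y
    using that line_closed_vimage[OF that(2)] image_X[OF that(2)]
    by (fastforce simp: R_def)
  have inv: "g ` C \<in> X // R" if g: "g \<in> G" and C: "C \<in> X // R" for g C
  proof -
    obtain x where x: "x \<in> X" "C = R `` {x}"
      using C by (auto elim: quotientE)
    have "g ` C = R `` {g x}"
    proof
      show "g ` C \<subseteq> R `` {g x}" using x R_G g by auto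
    next
      show "R `` {g x} \<subseteq> g ` C"
      proof
        fix y assume "y \<in> R `` {g x}"
        then have "(inv' g (g x), inv' g y) \<in> R"
          using R_G inv_closed[OF g] by auto
        then have "inv' g y \<in> C"
          using x permutes_inverses[OF permutes[OF g]] by simp
        then show "y \<in> g ` C"
          using permutes_inverses[OF permutes[OF g]] by (metis imageI)
      qed
    qed
    moreover have "g x \<in> X"
      using x image_X[OF g] by blast
    ultimately show ?thesis by (auto intro: quotientI)
  qed
  have "partition_on X (X // R)"
    using equiv by (rule partition_on_quotient)
  then have "X // R = {X} \<or> X // R = (\<lambda>x. {x}) ` X"
    using inv by (rule primitive_partition)
  moreover have "X // R \<noteq> (\<lambda>x. {x}) ` X"
  proof
    assume eq: "X // R = (\<lambda>x. {x}) ` X"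
    obtain T where T: "T \<in> lines" using two_lines_exist by blast
    obtain x y where xy: "x \<in> T" "y \<in> T" "x \<noteq> y"
      using card_line_ge_2[OF T] by (metis card_2_iff' card_le_Suc0_iff_eq card.infinite
          not_less_eq_eq numeral_2_eq_2 not_numeral_le_zero)
    have "(x, y) \<in> R"
      using T xy line_subset[OF T] by (auto simp: R_def line_closed_def)
    then have "x \<in> X" "{x, y} \<subseteq> R `` {x}"
      using equiv by (auto simp: R_def)
    then show False
      using eq xy(3) quotientI[of x X R] by auto
  qed
  ultimately have X: "X // R = {X}" by blast
  have "(x, y) \<in> R" if "x \<in> X" "y \<in> X" for x y
    using that X quotientI[of x X R] by auto
  then show ?thesis
    using B by (auto simp: R_def)
qed

section \<open>Distinct lines share at most one point\<close>

lemma line_clique: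
  assumes "minimal s" "T \<in> lines" "x \<in> T" "y \<in> T"
  shows "y \<in> closed_nbhd n G (s ` X) x"
  using nonsync_part_clique(2)[OF subgroup_G lines_m_pairs[OF assms(2,1)]] assms(3,4)
  by (auto simp: closed_nbhd_def pairwise_def)

lemma lines_meet:
  assumes m: "m_group n G \<le> 2" and T: "T \<in> lines" "T' \<in> lines"
    and x: "x \<in> T" "x \<in> T'" and y: "y \<in> T" "y \<in> T'" and "x \<noteq> y"
  shows "T = T'"
proof -
  obtain s where s: "minimal s" using minimal_exists by blast
  \<comment> \<open>Each point of the clique \<open>L'\<close> lies in the closed neighbourhoods of
    \<open>x\<close> and \<open>y\<close>, whose intersection lies in \<open>L\<close> by
    \<open>m_pair_inter\<close>. The claim is symmetric, so it yields both inclusions.\<close>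
  have "L' \<subseteq> L" if "L \<in> lines" "L' \<in> lines" "x \<in> L" "y \<in> L" "x \<in> L'" "y \<in> L'" for L L'
  proof
    fix z assume "z \<in> L'"
    then show "z \<in> L"
      using m_pair_inter[OF lines_m_pairs[OF that(1) s] m that(3,4) \<open>x \<noteq> y\<close>]
        line_clique[OF s that(2)] line_subset[OF that(2)] that(5,6)
      unfolding X_def by blast
  qed
  then show ?thesis
    using assms by blast
qed

section \<open>Fibres of \<open>t\<close> and the final contradiction\<close>

definition fibre :: "nat \<Rightarrow> nat set" where
  "fibre p = {x \<in> X. t x = p}"

lemma fibre_line:
  assumes m: "m_group n G \<le> 2" and x: "x \<in> fibre p" and y: "y \<in> fibre p" and "x \<noteq> y"
  shows "fibre p \<in> lines"
proof -
  have "p \<in> X"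
    using x M_image[OF t_in_M] by (auto simp: fibre_def)
  then obtain T T' where T: "T \<in> lines" "T' \<in> lines" "T \<noteq> T'" "p \<in> T" "p \<in> T'"
    by (rule two_lines)
  have "T \<inter> T' = {p}"
    using lines_meet[OF m T(1,2)] T(3-5) by blast
  let ?L = "{x \<in> X. t x \<in> T}" and ?L' = "{x \<in> X. t x \<in> T'}"
  have L: "?L \<in> lines" "?L' \<in> lines"
    using T line_vimage[OF t_in_M] by auto
  then have "?L = ?L'"
    using lines_meet[OF m L, of x y] x y T \<open>x \<noteq> y\<close> by (auto simp: fibre_def)
  moreover have "fibre p = ?L \<inter> ?L'"
    using \<open>T \<inter> T' = {p}\<close> by (auto simp: fibre_def)
  ultimately show ?thesis
    using L by simp
qed

lemma m_group_gt_2: "\<not> m_group n G \<le> 2"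
proof
  assume m: "m_group n G \<le> 2"
  obtain L where L: "L \<in> lines" using two_lines_exist by blast
  \<comment> \<open>By connectedness \<open>B\<close> will be empty or all of \<open>X\<close>, and
    either case makes the kernel of \<open>t\<close> uniform.\<close>
  define B where "B = {p \<in> X. card (fibre p) = 1}"
  have fin: "finite (fibre p)" for p
    by (simp add: fibre_def)
  have big: "fibre p \<in> lines" if "card (fibre p) > 1" for p
  proof -
    have "\<not> (\<forall>x\<in>fibre p. \<forall>y\<in>fibre p. x = y)"
      using that fin card_le_Suc0_iff_eq[of "fibre p"] by auto
    then show ?thesis using fibre_line[OF m] by blast
  qed
  have closed: "line_closed B"
    unfolding line_closed_def
  proof (intro ballI impI)
    fix T assume T: "T \<in> lines" and "T \<inter> B \<noteq> {}"
    then obtain q where q: "q \<in> T" "card (fibre q) = 1" by (auto simp: B_def)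
    have finT: "finite T" by (rule finite_subset[OF line_subset[OF T] finite_X])
    let ?L = "{x \<in> X. t x \<in> T}"
    have Tl: "?L \<in> lines" by (rule line_vimage[OF t_in_M T])
    have le: "card (fibre p) \<le> 1" if p: "p \<in> T" for p
    proof (rule ccontr)
      assume c: "\<not> card (fibre p) \<le> 1"
      then have "fibre p \<in> lines" using big by simp
      \<comment> \<open>Both are lines, of equal size, and one contains the other. All of
        \<open>?L\<close> is thus mapped to \<open>p\<close>, including the nonempty fibre over
        \<open>q\<close>.\<close>
      then have "fibre p = ?L"
        using p by (intro card_subset_eq card_lines[OF _ Tl]) (auto simp: fibre_def)
      moreover have "fibre q \<subseteq> ?L"
        using q by (auto simp: fibre_def)
      moreover have "fibre q \<noteq> {}"
        using q(2) by auto
      ultimately have "p = q" by (auto simp: fibre_def)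
      then show False using c q(2) by simp
    qed
    have inj: "inj_on t ?L"
    proof (rule inj_onI)
      fix x y assume "x \<in> ?L" "y \<in> ?L" "t x = t y"
      then show "x = y"
        using le[of "t x"] fin[of "t x"] by (auto simp: card_le_Suc0_iff_eq fibre_def)
    qed
    \<comment> \<open>Injectivity on \<open>?L\<close> and the equal sizes of \<open>?L\<close> and
      \<open>T\<close> give surjectivity onto \<open>T\<close>, which excludes empty fibres over
      points of \<open>T\<close>.\<close>
    have "t ` ?L = T"
    proof (rule card_subset_eq[OF finT])
      show "card (t ` ?L) = card T"
        using card_image[OF inj] card_lines[OF Tl T] by simp
    qed auto
    show "T \<subseteq> B"
    proof
      fix p assume p: "p \<in> T"
      then obtain x where "x \<in> ?L" "t x = p"
        using \<open>t ` ?L = T\<close> by (metis (no_types, lifting) imageE)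
      then have "fibre p \<noteq> {}"
        unfolding fibre_def by blast
      then have "card (fibre p) = 1"
        using le[OF p] fin[of p] by (metis card_0_eq le_neq_implies_less less_one)
      then show "p \<in> B"
        using p line_subset[OF T] by (auto simp: B_def)
    qed
  qed
  have parts: "kernel_partition n t = fibre ` t ` X"
    by (simp add: kernel_partition_X fibre_def)
  have "B \<noteq> {}"
  proof
    \<comment> \<open>Every nonempty fibre then has more than one point, hence is a line, and all
      lines have the same size.\<close>
    assume "B = {}"
    have "card (fibre (t x)) = card L" if "x \<in> X" for x
    proof -
      have "t x \<in> X" using that M_image[OF t_in_M] by blast
      then have "card (fibre (t x)) \<noteq> 1"
        using \<open>B = {}\<close> by (auto simp: B_def)
      moreover have "card (fibre (t x)) \<noteq> 0"
        using that by (auto simp: fibre_def)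
      ultimately show ?thesis
        using card_lines[OF big L] by simp
    qed
    then show False
      using nonuniform by (auto simp: parts uniform_def)
  qed
  then have "B = X"
    using line_closed_eq_X[OF closed] by (auto simp: B_def)
  then have "card (fibre p) = 1" if "p \<in> t ` X" for p
    using that M_image[OF t_in_M] by (auto simp: B_def)
  then show False
    using nonuniform by (auto simp: parts uniform_def)
qed

end

theorem theorem3p5:
  fixes n :: nat and G :: "(nat \<Rightarrow> nat) set"
  assumes "primitive_group n G"
    and "nonsynchronizing n G"
    and "m_group n G = 2"
    and "M_group_le n G (1 / 2)"
  shows "(\<forall>t\<in>full_transformations n. \<not> uniform (kernel_partition n t) \<longrightarrow>
            (\<exists>f\<in>semigroup_generated (insert t G). constant_map n f))
         \<and> almost_synchronizing n G"
proof -
  have "\<exists>f\<in>semigroup_generated (insert t G). constant_map n f"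
    if t: "t \<in> full_transformations n" "\<not> uniform (kernel_partition n t)" for t
  proof (rule ccontr)
    assume "\<not> ?thesis"
    \<comment> \<open>The absence of a constant map makes \<open>t\<close> a counterexample in the
      sense of the locale, where \<open>m_group n G\<close> must exceed 2.\<close>
    then interpret constant_free n G t
      using assms(1) t by unfold_locales auto
    show False using m_group_gt_2 assms(3) by simp
  qed
  then show ?thesis
    using assms(1) by (simp add: almost_synchronizing_def)
qed

end
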